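(* Fix $\alpha \in \mathbb{C}$ and an integer $x \geq 1$. Then (i) $$\widehat{S}_0^{(-\alpha)}(x) = \sum_{d=1}^x H^{(\alpha+1)}_{\lfloor x/d\rfloor}\cdot \frac{c_d(x)}{d^{\alpha+1}}\cdot \chi_{\mathbb{P}}(d);$$ (ii) $$\widehat{S}_1^{(-\alpha)}(x) = \sum_{p \leq x} \left[\sum_{k=1}^{\nu_p(x)} \frac{p-1}{p^{\alpha k + 1}} H^{(\alpha+1)}_{x/p^k} - \frac{1}{p^{\alpha \nu_p(x) + \alpha + 1}} H^{(\alpha+1)}_{\lfloor x/p^{\nu_p(x)+1}\rfloor}\right];$$ (iii) $$\widehat{S}_2^{(-\alpha)}(x) = \frac{(-1)^x}{2^{\alpha+1}}\sum_{p \leq x} \left[\sum_{k=1}^{\nu_p(x)} \frac{p-1}{p^{\alpha k + 1}} H^{(\alpha+1)}_{\lfloor x/(2p^k)\rfloor} - \frac{1}{p^{\alpha \nu_p(x) + \alpha + 1}} H^{(\alpha+1)}_{\lfloor x/(2p^{\nu_p(x)+1})\rfloor}\right],$$ with sums over $p$ ranging over primes. Moreover, $$\sigma_\alpha(x) = x^{\alpha}\left(H_x^{(\alpha+1)} + \widehat{S}_0^{(-\alpha)}(x) + \widehat{S}_1^{(-\alpha)}(x) + \widehat{S}_2^{(-\alpha)}(x)\right).$$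
   Context: $\sigma_\alpha(x) = \sum_{d \mid x} d^{\alpha}$; $H_n^{(r)} = \sum_{k=1}^n k^{-r}$. $c_d(x) = \sum_{r \mid \gcd(d,x)} r\,\mu(d/r)$ is Ramanujan's sum, $\mu$ the Möbius function. $\chi_{\mathbb{P}}(d)$ is the indicator function of the positive integers $d$ which are not of the form $p^k$ or $2p^k$ for a prime $p$ and $k \geq 1$. $\nu_p(n)$ is the exponent of the prime $p$ in $n$. $[q^x]F(q)$ is the coefficient of $q^x$ in the power series expansion of $F$ about $q=0$. $\Phi_n$ is the $n$-th cyclotomic polynomial, $\widetilde{\Phi}_n(q) := \frac{1}{q}\frac{d}{dw}[\log\Phi_n(w)]|_{w=1/q}$, and for $n\ge2$, $\Pi_n(q) := \sum_{j=0}^{n-2}\frac{(n-1-j)q^j(1-q)}{1-q^n}$. For $n\ge1$: $\widetilde{S}_{0,n}(q) = \sum_{d\mid n,\ d>1,\ d\ne p^k,2p^k}\widetilde{\Phi}_d(q)$, $\widetilde{S}_{1,n}(q) = \sum_{p\mid n}\Pi_{p^{\nu_p(n)}}(q)$, $\widetilde{S}_{2,n}(q) = \sum_{2p\mid n,\ p>2}\Pi_{p^{\nu_p(n)}}(-q)$ (sums over primes $p$). For $\beta \in \mathbb{C}$ and $i=0,1,2$, $\widehat{S}_i^{(\beta)}(x) := [q^x]\sum_{n=1}^x \widetilde{S}_{i,n}(q)\, n^{\beta-1}$.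
   Formalization: In (i) the sum starts at d=2, since the printed d=1 term adds H_x^{(α+1)} (false at x=1); in (iii) the sum runs over odd primes 2<p≤x, since the printed p=2 term makes the formula false (e.g. x=5). *)

theory Defs
  imports "HOL-Complex_Analysis.Complex_Analysis" "HOL-Computational_Algebra.Computational_Algebra"
begin

definition divisor_sigma :: "complex \<Rightarrow> nat \<Rightarrow> complex" where
  "divisor_sigma \<alpha> x = (\<Sum>d | d dvd x. of_nat d powr \<alpha>)"

definition gen_harm :: "nat \<Rightarrow> complex \<Rightarrow> complex" where
  "gen_harm n r = (\<Sum>k=1..n. of_nat k powr (- r))"

definition moebius_mu :: "nat \<Rightarrow> int" where
  "moebius_mu n = (if squarefree n then (-1) ^ card (prime_factors n) else 0)"

definition ramanujan_sum :: "nat \<Rightarrow> nat \<Rightarrow> int" where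
  "ramanujan_sum d x = (\<Sum>r | r dvd gcd d x. int r * moebius_mu (d div r))"

definition prime_power_or_double :: "nat \<Rightarrow> bool" where
  "prime_power_or_double d \<longleftrightarrow> (\<exists>p k. prime p \<and> k \<ge> 1 \<and> (d = p ^ k \<or> d = 2 * p ^ k))"

(* chi_P 1 = 1, since k >= 1 in the excluded forms, but S0_tilde omits the divisor d = 1.  Hence the
   formula for S0_hat has to start its sum over d at 2: a term d = 1 would add H_x^(alpha+1). *)
definition chi_P :: "nat \<Rightarrow> complex" where
  "chi_P d = (if prime_power_or_double d then 0 else 1)"

definition cyclotomic :: "nat \<Rightarrow> complex poly" where
  "cyclotomic n = (\<Prod>k | k \<in> {1..n} \<and> coprime k n. [:- cis (2 * pi * real k / real n), 1:])"

(* d/dw log Phi_n(w) is the logarithmic derivative Phi_n'(w) / Phi_n(w); no branch of the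
   logarithm is chosen.  At q = 0 this is a removable singularity, at which the definition takes
   a junk value; see power_series_coeff. *)
definition Phi_tilde :: "nat \<Rightarrow> complex \<Rightarrow> complex" where
  "Phi_tilde n q =
     1 / q * (poly (pderiv (cyclotomic n)) (1 / q) / poly (cyclotomic n) (1 / q))"

(* Only meaningful for n >= 2. *)
definition Pi_fun :: "nat \<Rightarrow> complex \<Rightarrow> complex" where
  "Pi_fun n q = (\<Sum>j=0..n-2. of_nat (n - 1 - j) * q ^ j * (1 - q) / (1 - q ^ n))"

definition S0_tilde :: "nat \<Rightarrow> complex \<Rightarrow> complex" where
  "S0_tilde n q = (\<Sum>d | d dvd n \<and> d > 1 \<and> \<not> prime_power_or_double d. Phi_tilde d q)"

definition S1_tilde :: "nat \<Rightarrow> complex \<Rightarrow> complex" where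
  "S1_tilde n q = (\<Sum>p | prime p \<and> p dvd n. Pi_fun (p ^ multiplicity p n) q)"

(* Only odd primes occur here, so the formula for S2_hat has to range over odd primes too: with a
   term p = 2 it would fail, for instance at x = 5. *)
definition S2_tilde :: "nat \<Rightarrow> complex \<Rightarrow> complex" where
  "S2_tilde n q = (\<Sum>p | prime p \<and> p > 2 \<and> 2 * p dvd n. Pi_fun (p ^ multiplicity p n) (- q))"

(* [q^x] F(q).  remove_sings fills in the removable singularity that the functions built from
   Phi_tilde have at q = 0. *)
definition power_series_coeff :: "(complex \<Rightarrow> complex) \<Rightarrow> nat \<Rightarrow> complex" where
  "power_series_coeff F x = fps_nth (fps_expansion (remove_sings F) 0) x"

definition S_hat :: "(nat \<Rightarrow> complex \<Rightarrow> complex) \<Rightarrow> complex \<Rightarrow> nat \<Rightarrow> complex" where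
  "S_hat S \<beta> x = power_series_coeff (\<lambda>q. \<Sum>n=1..x. S n q * of_nat n powr (\<beta> - 1)) x"

abbreviation "S0_hat \<equiv> S_hat S0_tilde"
abbreviation "S1_hat \<equiv> S_hat S1_tilde"
abbreviation "S2_hat \<equiv> S_hat S2_tilde"

end

theory Submission
  imports Defs "HOL-Number_Theory.Totient"
begin

text \<open>
  Expanding the logarithmic derivative of \<open>\<Phi>\<^sub>d\<close> over its roots, \<open>\<Phi>\<close>-tilde is the sum of
  \<open>1 / (1 - \<zeta> q)\<close> over the primitive \<open>d\<close>-th roots of unity, so its \<open>x\<close>-th coefficient is the
  Ramanujan sum \<open>c\<^sub>d(x)\<close>. The \<open>x\<close>-th coefficient of \<open>\<Pi>\<close> at \<open>p\<^sup>a\<close> is the sum of \<open>c\<^sub>d(x)\<close> over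
  \<open>d = p, p\<^sup>2, \<dots>\<close> up to \<open>p\<^sup>a\<close>, and for odd \<open>p\<close> replacing \<open>q\<close> by \<open>-q\<close> turns these into the Ramanujan sums at
  \<open>2p, 2p\<^sup>2, \<dots>\<close>. Hence the three coefficients together with the divisor 1 collect
  \<open>c\<^sub>d(x)\<close> over all divisors \<open>d\<close> of \<open>n\<close>, which adds up to \<open>n\<close> if \<open>n\<close> divides \<open>x\<close> and to 0 otherwise.
  The individual formulas follow by exchanging the sums over \<open>n\<close> and \<open>d\<close>.
\<close>

section \<open>Coefficient extraction at a removable singularity\<close>

text \<open>A Laurent expansion ignores the junk value at 0. Without negative powers,
  \<open>F\<close> tends to the constant coefficient at 0; \<open>remove_sings\<close> inserts this
  limit and so yields a genuine power series. Hence all expansions below may be proved on a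
  punctured neighbourhood.\<close>

lemma power_series_coeff_eqI:
  assumes F: "F has_laurent_expansion fps_to_fls g"
  shows "power_series_coeff F x = fps_nth g x"
proof -
  have "remove_sings F 0 = fps_nth g 0"
    using has_laurent_expansion_imp_tendsto_0[OF F fls_subdegree_fls_to_fps_gt0]
    by (simp add: remove_sings_eqI)
  hence "remove_sings F has_fps_expansion g"
    using remove_sings_has_laurent_expansion[OF F] by (simp add: has_fps_expansion_to_laurent)
  thus ?thesis
    by (simp add: power_series_coeff_def fps_expansion_eqI)
qed

lemma has_laurent_expansion_fps_sum:
  assumes "\<And>i. i \<in> I \<Longrightarrow> f i has_laurent_expansion fps_to_fls (Abs_fps (a i))"
  shows "(\<lambda>q. \<Sum>i\<in>I. f i q) has_laurent_expansion fps_to_fls (Abs_fps (\<lambda>x. \<Sum>i\<in>I. a i x))"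
proof -
  have eq: "(\<Sum>i\<in>I. fps_to_fls (Abs_fps (a i))) = fps_to_fls (Abs_fps (\<lambda>x. \<Sum>i\<in>I. a i x))"
  proof (rule fls_eqI)
    fix k :: int
    show "fls_nth (\<Sum>i\<in>I. fps_to_fls (Abs_fps (a i))) k = 
      fls_nth (fps_to_fls (Abs_fps (\<lambda>x. \<Sum>i\<in>I. a i x))) k"
      \<comment> \<open>For infinite \<open>I\<close> both sides are zero; such index sets arise
        later from the divisors of \<open>n = 0\<close>.\<close>
      by (induction I rule: infinite_finite_induct) (auto split: if_splits)
  qed
  show ?thesis
    unfolding eq[symmetric] by (intro has_laurent_expansion_sum assms)
qed

lemma S_hat_eq:
  assumes "\<And>n. n \<in> {1..x} \<Longrightarrow> S n has_laurent_expansion fps_to_fls (Abs_fps (s n))"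
  shows "S_hat S \<beta> x = (\<Sum>n=1..x. s n x * of_nat n powr (\<beta> - 1))"
proof -
  \<comment> \<open>The coefficient index \<open>y\<close> is kept apart from \<open>x\<close>,
    which also bounds the sum and must stay fixed while the series is formed.\<close>
  have "(\<lambda>q. \<Sum>n=1..x. S n q * of_nat n powr (\<beta> - 1)) has_laurent_expansion
     fps_to_fls (Abs_fps (\<lambda>y. \<Sum>n=1..x. s n y * of_nat n powr (\<beta> - 1)))"
  proof (rule has_laurent_expansion_fps_sum)
    fix n assume "n \<in> {1..x}"
    from has_laurent_expansion_cmult_right[OF assms[OF this], of "of_nat n powr (\<beta> - 1)"]
    show "(\<lambda>q. S n q * of_nat n powr (\<beta> - 1)) has_laurent_expansion
        fps_to_fls (Abs_fps (\<lambda>y. s n y * of_nat n powr (\<beta> - 1)))"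
      by (rule has_laurent_expansion_schematicI) (auto intro!: fls_eqI)
  qed
  thus ?thesis
    by (simp add: S_hat_def power_series_coeff_eqI)
qed

section \<open>Expansion of \<open>Phi_tilde\<close> over the primitive roots of unity\<close>

lemma poly_log_deriv_prod_roots:
  fixes r :: "'b \<Rightarrow> 'a :: field"
  assumes "finite A" "\<And>i. i \<in> A \<Longrightarrow> w \<noteq> r i"
  shows "poly (pderiv (\<Prod>i\<in>A. [:- r i, 1:])) w / poly (\<Prod>i\<in>A. [:- r i, 1:]) w
         = (\<Sum>i\<in>A. 1 / (w - r i))"
  using assms
proof (induction A rule: finite_induct)
  case (insert i A)
  have nz: "poly (\<Prod>i\<in>A. [:- r i, 1:]) w \<noteq> 0"
    using insert by (auto simp: poly_prod)
  have nz': "w - r i \<noteq> 0"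
    using insert by auto
  define P where "P = (\<Prod>i\<in>A. [:- r i, 1:])"
  have "poly (pderiv (\<Prod>i\<in>insert i A. [:- r i, 1:])) w
      = poly (pderiv P) w * (w - r i) + poly P w"
    unfolding P_def prod.insert[OF insert.hyps] pderiv_mult
    by (simp add: pderiv_pCons del: mult_pCons_left mult_pCons_right)
  moreover have "poly (\<Prod>i\<in>insert i A. [:- r i, 1:]) w = (w - r i) * poly P w"
    unfolding P_def prod.insert[OF insert.hyps] poly_mult by simp
  ultimately have "poly (pderiv (\<Prod>i\<in>insert i A. [:- r i, 1:])) w / poly (\<Prod>i\<in>insert i A. [:- r i, 1:]) w
     = 1 / (w - r i) + poly (pderiv P) w / poly P w"
    using nz nz' unfolding P_def[symmetric] by (simp add: add_divide_distrib)
  thus ?case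
    using insert by (simp add: P_def)
qed (simp add: pderiv_1)

text \<open>Ramanujan's sum in trigonometric form, as the expansion of \<open>Phi_tilde\<close>
  produces it. Agreement with the divisor form \<open>ramanujan_sum\<close> is shown later for
  \<open>d > 0\<close>.\<close>

definition primitive_root_sum :: "nat \<Rightarrow> nat \<Rightarrow> complex" where
  "primitive_root_sum d x =
     (\<Sum>k | k \<in> {1..d} \<and> coprime k d. cis (2 * pi * real k / real d) ^ x)"

lemma inverse_one_minus_X_power:
  assumes "n > 0"
  shows "inverse (1 - fps_X ^ n :: 'a :: field fps) = Abs_fps (\<lambda>x. if n dvd x then 1 else 0)"
proof (rule fps_inverse_unique, rule fps_ext)
  fix m
  show "((1 - fps_X ^ n) * Abs_fps (\<lambda>x. if n dvd x then 1 else (0::'a))) $ m = 1 $ m"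
    using assms by (auto simp: left_diff_distrib fps_X_power_mult_nth dvd_minus_self dest: dvd_imp_le)
qed

lemma geometric_fps:
  fixes c :: complex
  shows "(\<lambda>q. 1 / (1 - c * q)) has_fps_expansion Abs_fps (\<lambda>x. c ^ x)"
proof -
  have "inverse (1 - fps_const c * fps_X) = Abs_fps (\<lambda>x. c ^ x)"
  proof (rule fps_inverse_unique, rule fps_ext)
    fix m
    show "((1 - fps_const c * fps_X) * Abs_fps (\<lambda>x. c ^ x)) $ m = 1 $ m"
      by (cases m) (auto simp: left_diff_distrib mult.assoc)
  qed
  moreover have "(\<lambda>q. inverse (1 - c * q)) has_fps_expansion inverse (1 - fps_const c * fps_X)"
    by (intro fps_expansion_intros) auto
  ultimately show ?thesis
    by (simp add: divide_inverse)
qed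

text \<open>The factor \<open>1 / q\<close> turns each \<open>1 / (1 / q - r)\<close> into
  \<open>1 / (1 - r * q)\<close>, a geometric series. The identity holds only for
  \<open>q \<noteq> 0\<close>, so the expansion is a Laurent one.\<close>

lemma Phi_tilde_expansion:
  "Phi_tilde d has_laurent_expansion fps_to_fls (Abs_fps (primitive_root_sum d))"
proof -
  let ?A = "{k. k \<in> {1..d} \<and> coprime k d}"
  let ?r = "\<lambda>k. cis (2 * pi * real k / real d)"
  have "\<forall>\<^sub>F q in at 0. q \<in> ball 0 1 - {0::complex}"
    by (intro eventually_at_in_open) auto
  hence "\<forall>\<^sub>F q in at 0. (\<Sum>k\<in>?A. 1 / (1 - ?r k * q)) = Phi_tilde d q"
  proof eventually_elim
    case (elim q)
    hence q: "q \<noteq> 0" "norm q < 1" by auto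
    \<comment> \<open>In the punctured unit disc \<open>1 / q\<close> has modulus above 1 and so
      misses every root of \<open>cyclotomic d\<close>.\<close>
    have ne: "1 / q \<noteq> ?r k" for k
    proof
      assume "1 / q = ?r k"
      hence "norm (1 / q) = 1" by simp
      with q show False by (simp add: norm_divide)
    qed
    have ne': "1 - ?r k * q \<noteq> 0" for k
      using ne[of k] q by (auto simp: field_simps)
    have "Phi_tilde d q = 1 / q * (\<Sum>k\<in>?A. 1 / (1 / q - ?r k))"
      unfolding Phi_tilde_def cyclotomic_def by (subst poly_log_deriv_prod_roots) (use ne in auto)
    also have "\<dots> = (\<Sum>k\<in>?A. 1 / (1 - ?r k * q))"
      unfolding sum_distrib_left by (intro sum.cong refl) (use q ne' in \<open>simp add: field_simps\<close>)
    finally show ?case ..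
  qed
  moreover have "(\<lambda>q. \<Sum>k\<in>?A. 1 / (1 - ?r k * q)) has_laurent_expansion
      fps_to_fls (Abs_fps (\<lambda>x. \<Sum>k\<in>?A. ?r k ^ x))"
    by (intro has_laurent_expansion_fps_sum has_laurent_expansion_fps geometric_fps)
  ultimately show ?thesis
    unfolding primitive_root_sum_def by (subst (asm) has_laurent_expansion_cong) auto
qed

section \<open>Expansion of \<open>Pi_fun\<close>\<close>

text \<open>Raising \<open>n\<close> by one adds \<open>q ^ j * (1 - q)\<close> for each
  \<open>j < n\<close>; these terms telescope to \<open>1 - q ^ n\<close>, which is also the
  increment of the right-hand side.\<close>

lemma geometric_weighted_sum:
  fixes q :: "'a :: comm_ring_1"
  assumes "n > 0"
  shows "(\<Sum>j=0..n-2. of_nat (n - 1 - j) * q ^ j * (1 - q)) = of_nat n - (\<Sum>j<n. q ^ j)"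
  using assms
proof (induction n rule: nat_induct_non_zero)
  case (Suc n)
  show ?case
  \<comment> \<open>The bound \<open>n - 2\<close> truncates at \<open>n = 1\<close>, so the step
    from 1 to 2 is computed directly.\<close>
  proof (cases "n = 1")
    case False
    with Suc.hyps obtain m where m: "n = Suc (Suc m)"
      by (metis One_nat_def not0_implies_Suc not_gr0)
    have "(\<Sum>j=0..Suc n-2. of_nat (Suc n - 1 - j) * q ^ j * (1 - q))
        = (\<Sum>j=0..Suc m. of_nat (n - 1 - j) * q ^ j * (1 - q) + q ^ j * (1 - q))"
      unfolding m by (intro sum.cong) (auto simp: Suc_diff_le algebra_simps)
    \<comment> \<open>The weight \<open>n - 1 - j\<close> vanishes at the top index
      \<open>j = Suc m\<close>, so the weighted sum may stop at \<open>n - 2\<close>.\<close>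
    also have "\<dots> = (\<Sum>j=0..n-2. of_nat (n - 1 - j) * q ^ j * (1 - q)) + (\<Sum>j<n. q ^ j) * (1 - q)"
      unfolding m sum.distrib sum_distrib_right by (simp add: lessThan_Suc_atMost atMost_atLeast0)
    also have "(\<Sum>j<n. q ^ j) * (1 - q) = 1 - q ^ n"
      by (metis mult.commute one_diff_power_eq)
    finally show ?thesis
      using Suc.IH by simp
  qed (auto simp: algebra_simps)
qed auto

text \<open>Near 0 the function equals \<open>n / (1 - q ^ n) - 1 / (1 - q)\<close>: the first
  series lives on the multiples of \<open>n\<close>, the second has all coefficients 1.\<close>

lemma Pi_fun_expansion:
  assumes "n > 0"
  shows "Pi_fun n has_fps_expansion Abs_fps (\<lambda>x. (if n dvd x then of_nat n else 0) - 1)"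
proof -
  let ?A = "Abs_fps (\<lambda>x. if n dvd x then 1 else 0) :: complex fps"
  have A: "(\<lambda>q. inverse (1 - q ^ n)) has_fps_expansion ?A"
    unfolding inverse_one_minus_X_power[OF assms, symmetric]
    by (intro fps_expansion_intros) (use assms in auto)
  have "(\<lambda>q. of_nat n * inverse (1 - q ^ n) - 1 / (1 - 1 * q)) has_fps_expansion
       fps_const (of_nat n) * ?A - Abs_fps (\<lambda>x. 1 ^ x)"
    by (intro fps_expansion_intros A geometric_fps)
  also have "fps_const (of_nat n) * ?A - Abs_fps (\<lambda>x. 1 ^ x) =
      Abs_fps (\<lambda>x. (if n dvd x then of_nat n else 0) - 1)"
    by (auto intro!: fps_ext)
  finally have *: "(\<lambda>q. of_nat n * inverse (1 - q ^ n) - 1 / (1 - 1 * q)) has_fps_expansion \<dots>" .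
  have "\<forall>\<^sub>F q in nhds 0. q \<in> ball (0::complex) 1"
    by (intro eventually_nhds_in_open) auto
  hence "\<forall>\<^sub>F q in nhds 0. of_nat n * inverse (1 - q ^ n) - 1 / (1 - 1 * q) = Pi_fun n q"
  proof eventually_elim
    case (elim q)
    hence q: "norm q < 1" by simp
    hence "norm (q ^ n) < 1"
      using assms by (simp add: norm_power power_less_one_iff)
    hence nz: "1 - q ^ n \<noteq> 0" by auto
    have nz': "1 - q \<noteq> 0" using q by auto
    have "Pi_fun n q = (of_nat n - (\<Sum>j<n. q ^ j)) / (1 - q ^ n)"
      unfolding Pi_fun_def sum_divide_distrib[symmetric] geometric_weighted_sum[OF assms] ..
    also have "(\<Sum>j<n. q ^ j) = (1 - q ^ n) / (1 - q)"
      using nz' by (simp add: one_diff_power_eq)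
    finally show ?case
      using nz nz' by (simp add: field_simps)
  qed
  with * show ?thesis
    by (subst (asm) has_fps_expansion_cong) auto
qed

lemma has_fps_expansion_uminus_arg:
  fixes f :: "complex \<Rightarrow> complex"
  assumes "f has_fps_expansion Abs_fps a"
  shows "(\<lambda>q. f (- q)) has_fps_expansion Abs_fps (\<lambda>x. (-1) ^ x * a x)"
proof -
  have "(f \<circ> (\<lambda>q. - q)) has_fps_expansion (Abs_fps a oo (- fps_X))"
    by (rule has_fps_expansion_compose[OF assms]) (auto intro!: fps_expansion_intros)
  moreover have "Abs_fps a oo (- fps_X) = Abs_fps (\<lambda>x. (-1) ^ x * a x)"
    by (simp add: fps_compose_uminus')
  ultimately show ?thesis
    by (simp add: o_def)
qed

section \<open>Divisor sums of the Moebius function and of Ramanujan's sum\<close>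

lemma moebius_mu_prime_mult:
  assumes "prime p" "\<not> p dvd d"
  shows "moebius_mu (p * d) = - moebius_mu d"
proof -
  have d: "d \<noteq> 0" using assms(2) by (intro notI) simp
  have cop: "coprime p d" using assms by (simp add: prime_imp_coprime)
  have "prime_factors (p * d) = insert p (prime_factors d)"
    using assms d by (auto simp: prime_factors_product prime_prime_factors)
  moreover have "p \<notin> prime_factors d"
    using assms by auto
  moreover have "squarefree (p * d) \<longleftrightarrow> squarefree d"
    using squarefree_mult_coprime[OF cop squarefree_prime[OF assms(1)]] squarefree_multD(2) by auto
  ultimately show ?thesis
    by (simp add: moebius_mu_def)
qed

lemma moebius_mu_eq_0:
  assumes "p ^ 2 dvd d" "prime p"
  shows "moebius_mu d = 0"
  using not_squarefreeI[OF assms(1)] assms(2) not_prime_unit by (auto simp: moebius_mu_def)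

text \<open>Fix a prime \<open>p\<close> dividing \<open>n\<close>. Multiplication by
  \<open>p\<close> maps the divisors not divisible by \<open>p\<close> injectively into those
  divisible by \<open>p\<close> and flips the sign, so these contributions cancel.\<close>

lemma sum_moebius_mu:
  assumes "n > 0"
  shows "(\<Sum>d | d dvd n. moebius_mu d) = (if n = 1 then 1 else 0)"
proof (cases "n = 1")
  case False
  then obtain p where p: "prime p" "p dvd n"
    using prime_factor_nat by blast
  let ?A = "{d. d dvd n \<and> \<not> p dvd d}" and ?B = "{d. d dvd n \<and> p dvd d}"
  have fin: "finite {d. d dvd n}" using assms by simp
  have inj: "inj_on ((*) p) ?A" using p by (auto simp: inj_on_def prime_gt_0_nat)
  have sub: "(*) p ` ?A \<subseteq> ?B"
    using p by (auto intro!: divides_mult prime_imp_coprime)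
  \<comment> \<open>The multiples of \<open>p\<close> missed by the injection are divisible by
    \<open>p ^ 2\<close>.\<close>
  have "moebius_mu d = 0" if d: "d \<in> ?B - (*) p ` ?A" for d
  proof -
    from d obtain e where e: "d = p * e" by auto
    with d have "p dvd e" by (auto simp: image_iff dest: dvd_mult_right)
    hence "p ^ 2 dvd d" by (simp add: e power2_eq_square)
    with p(1) show ?thesis by (intro moebius_mu_eq_0)
  qed
  hence "sum moebius_mu ?B = sum moebius_mu ((*) p ` ?A)"
    using fin sub by (intro sum.mono_neutral_right) auto
  also have "\<dots> = (\<Sum>d\<in>?A. moebius_mu (p * d))"
    using inj by (simp add: sum.reindex)
  also have "\<dots> = - sum moebius_mu ?A"
    unfolding sum_negf[symmetric] by (intro sum.cong) (use p in \<open>auto simp: moebius_mu_prime_mult\<close>)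
  finally have "sum moebius_mu ?A + sum moebius_mu ?B = 0" by simp
  moreover have "sum moebius_mu (?A \<union> ?B) = sum moebius_mu ?A + sum moebius_mu ?B"
    using fin by (intro sum.union_disjoint) auto
  moreover have "?A \<union> ?B = {d. d dvd n}" by auto
  ultimately show ?thesis using False by simp
qed (simp add: moebius_mu_def)

text \<open>Write \<open>d = r * e\<close> and sum over \<open>e\<close> first: the Moebius sum over
  the divisors of \<open>n div r\<close> leaves only \<open>r = n\<close>.\<close>

lemma sum_divisors_ramanujan_sum:
  assumes "n > 0"
  shows "(\<Sum>d | d dvd n. ramanujan_sum d x) = (if n dvd x then int n else 0)"
proof -
  have fin: "finite {d. d dvd n}" using assms by simp
  have finr: "finite {r. r dvd gcd d x}" if "d dvd n" for d
    using that assms by (intro finite_divisors_nat) (auto intro: Nat.gr0I)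
  have "(\<Sum>d | d dvd n. ramanujan_sum d x) =
      (\<Sum>(d, r)\<in>(SIGMA d:{d. d dvd n}. {r. r dvd gcd d x}). int r * moebius_mu (d div r))"
    unfolding ramanujan_sum_def by (rule sum.Sigma) (use fin finr in auto)
  also have "\<dots> = (\<Sum>(r, e)\<in>(SIGMA r:{r. r dvd n \<and> r dvd x}. {e. e dvd n div r}). int r * moebius_mu e)"
    by (rule sum.reindex_bij_witness[of _ "\<lambda>(r, e). (r * e, r)" "\<lambda>(d, r). (r, d div r)"])
       (use assms in \<open>auto elim!: dvdE intro: Nat.gr0I\<close>)
  also have "\<dots> = (\<Sum>r | r dvd n \<and> r dvd x. \<Sum>e | e dvd n div r. int r * moebius_mu e)"
    by (rule sum.Sigma[symmetric]) (use assms fin in \<open>auto intro!: finite_divisors_nat Nat.gr0I elim!: dvdE\<close>)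
  also have "\<dots> = (\<Sum>r | r dvd n \<and> r dvd x. if r = n then int r else 0)"
  proof (rule sum.cong)
    fix r assume "r \<in> {r. r dvd n \<and> r dvd x}"
    hence "n div r > 0" "n div r = 1 \<longleftrightarrow> r = n"
      using assms by (auto elim!: dvdE)
    thus "(\<Sum>e | e dvd n div r. int r * moebius_mu e) = (if r = n then int r else 0)"
      by (simp add: sum_distrib_left[symmetric] sum_moebius_mu)
  qed auto
  also have "\<dots> = (if n dvd x then int n else 0)"
    using fin by (simp add: sum.delta' sum.delta if_distrib cong: if_cong)
  finally show ?thesis .
qed

section \<open>Equality of the trigonometric and the arithmetic Ramanujan sum\<close>

lemma cis_eq_1_iff_dvd:
  assumes "n > 0"
  shows "cis (2 * pi * real x / real n) = 1 \<longleftrightarrow> n dvd x"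
proof
  assume "cis (2 * pi * real x / real n) = 1"
  hence "cos (2 * pi * real x / real n) = 1" by (simp add: complex_eq_iff)
  then obtain m :: int where "2 * pi * real x / real n = of_int m * 2 * pi"
    by (subst (asm) cos_one_2pi_int) blast
  hence "real x = of_int m * real n"
    using assms by (simp add: field_simps)
  hence "real_of_int (int x) = real_of_int (m * int n)" by simp
  hence "int x = m * int n" by (simp only: of_int_eq_iff)
  thus "n dvd x" by (metis dvd_triv_right int_dvd_int_iff)
next
  assume "n dvd x"
  then obtain m where "x = n * m" ..
  thus "cis (2 * pi * real x / real n) = 1"
    using assms cis_multiple_2pi[of "real m"] by (simp add: mult.assoc)
qed

text \<open>All terms are powers \<open>w ^ k\<close> of one \<open>n\<close>-th root of unity
  \<open>w\<close>. Their sum is \<open>n\<close> if \<open>w = 1\<close>, and otherwise a vanishing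
  geometric sum.\<close>

lemma sum_all_root_powers:
  assumes "n > 0"
  shows "(\<Sum>k=1..n. cis (2 * pi * real k / real n) ^ x) = (if n dvd x then of_nat n else 0)"
proof -
  define w where "w = cis (2 * pi * real x / real n)"
  have w: "cis (2 * pi * real k / real n) ^ x = w ^ k" for k
    by (simp add: w_def Complex.DeMoivre mult_ac)
  have "w ^ n = cis (2 * pi * real x)"
    using assms by (simp add: w_def Complex.DeMoivre)
  hence wn: "w ^ n = 1" using cis_multiple_2pi[of "real x"] by simp
  have "(\<Sum>k=1..n. w ^ k) = w * (\<Sum>k<n. w ^ k)"
    unfolding sum_distrib_left
    by (rule sum.reindex_bij_witness[of _ Suc "\<lambda>k. k - 1"]) (auto simp flip: power_Suc)
  also have "\<dots> = (if n dvd x then of_nat n else 0)"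
    using wn cis_eq_1_iff_dvd[OF assms, of x] by (auto simp: w_def[symmetric] geometric_sum)
  finally show ?thesis by (simp add: w)
qed

text \<open>Sorting \<open>k\<close> by \<open>gcd k n = d\<close> and cancelling \<open>d\<close>
  turns the \<open>n\<close>-th roots of unity into the primitive roots of order
  \<open>n div d\<close>.\<close>

lemma sum_divisors_primitive_root_sum:
  assumes "n > 0"
  shows "(\<Sum>d | d dvd n. primitive_root_sum d x) = (if n dvd x then of_nat n else 0)"
proof -
  have fin: "finite {d. d dvd n}" using assms by simp
  have tot: "{k. k \<in> {1..d} \<and> coprime k d} = totatives d" for d
    by (auto simp: totatives_def)
  let ?f = "\<lambda>k. cis (2 * pi * real k / real n) ^ x"
  have "(\<Sum>k=1..n. ?f k) = (\<Sum>k\<in>(\<Union>d\<in>{d. d dvd n}. {k\<in>{0<..n}. gcd k n = d}). ?f k)"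
    by (rule sum.cong) auto
  also have "\<dots> = (\<Sum>d | d dvd n. \<Sum>k\<in>{k\<in>{0<..n}. gcd k n = d}. ?f k)"
    using fin by (intro sum.UNION_disjoint) auto
  also have "\<dots> = (\<Sum>d | d dvd n. primitive_root_sum (n div d) x)"
  proof (rule sum.cong)
    fix d assume "d \<in> {d. d dvd n}"
    hence d: "d dvd n" by simp
    then obtain e where e: "n = d * e" ..
    have "(\<Sum>k\<in>{k\<in>{0<..n}. gcd k n = d}. ?f k) = (\<Sum>k\<in>totatives (n div d). ?f (k * d))"
      by (rule sum.reindex_bij_betw[symmetric]) (rule bij_betw_totatives_gcd_eq[OF d assms])
    also have "\<dots> = primitive_root_sum (n div d) x"
      unfolding primitive_root_sum_def tot using assms by (intro sum.cong) (auto simp: e field_simps)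
    finally show "(\<Sum>k\<in>{k\<in>{0<..n}. gcd k n = d}. ?f k) = primitive_root_sum (n div d) x" .
  qed auto
  also have "\<dots> = (\<Sum>d | d dvd n. primitive_root_sum d x)" using assms
    by (intro sum.reindex_bij_witness[of _ "(div) n" "(div) n"]) (auto elim: dvdE)
  finally show ?thesis
    using sum_all_root_powers[OF assms, of x] by simp
qed

text \<open>Uniqueness in Moebius inversion: by strong induction the terms at proper divisors agree,
  hence so do those at \<open>n\<close>.\<close>

lemma divisor_sums_eq_imp_eq:
  fixes f g :: "nat \<Rightarrow> 'a :: ab_group_add"
  assumes "\<And>n. n > 0 \<Longrightarrow> (\<Sum>d | d dvd n. f d) = (\<Sum>d | d dvd n. g d)" and "n > 0"
  shows "f n = g n"
  using assms(2)
proof (induction n rule: less_induct)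
  case (less n)
  have split: "(\<Sum>d | d dvd n. h d) = h n + (\<Sum>d\<in>{d. d dvd n} - {n}. h d)" for h :: "nat \<Rightarrow> 'a"
    using less.prems by (intro sum.remove) auto
  have "(\<Sum>d\<in>{d. d dvd n} - {n}. f d) = (\<Sum>d\<in>{d. d dvd n} - {n}. g d)"
    using less.prems by (intro sum.cong less.IH) (auto dest: dvd_imp_le intro: Nat.gr0I)
  with assms(1)[OF less.prems] show ?case
    unfolding split[of f] split[of g] by simp
qed

text \<open>Both functions of \<open>d\<close> have the same divisor sums: \<open>n\<close> if
  \<open>n dvd x\<close>, and 0 otherwise.\<close>

lemma primitive_root_sum_eq_ramanujan_sum:
  assumes "d > 0"
  shows "primitive_root_sum d x = of_int (ramanujan_sum d x)"
proof (rule divisor_sums_eq_imp_eq[of "\<lambda>d. primitive_root_sum d x", OF _ assms])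
  fix n :: nat assume n: "n > 0"
  show "(\<Sum>d | d dvd n. primitive_root_sum d x) = (\<Sum>d | d dvd n. of_int (ramanujan_sum d x))"
    using sum_divisors_ramanujan_sum[OF n, of x] sum_divisors_primitive_root_sum[OF n, of x]
    by (simp flip: of_int_sum)
qed

section \<open>Ramanujan sums at prime powers and their doubles\<close>

lemma ramanujan_sum_1 [simp]: "ramanujan_sum (Suc 0) x = 1"
  by (simp add: ramanujan_sum_def moebius_mu_def)

lemma divisors_prime_power:
  assumes "prime (p :: nat)"
  shows "{d. d dvd p ^ a} = (\<lambda>k. p ^ k) ` {..a}"
  using divides_primepow_nat[OF assms] by auto

lemma sum_ramanujan_sum_prime_powers_atMost:
  assumes "prime p"
  shows "(\<Sum>k\<le>a. ramanujan_sum (p ^ k) x) = (if p ^ a dvd x then int (p ^ a) else 0)"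
proof -
  have "inj_on (\<lambda>k. p ^ k) {..a}"
    using assms by (auto simp: inj_on_def dest: prime_power_inj)
  hence "(\<Sum>k\<le>a. ramanujan_sum (p ^ k) x) = (\<Sum>d | d dvd p ^ a. ramanujan_sum d x)"
    unfolding divisors_prime_power[OF assms] by (simp add: sum.reindex)
  thus ?thesis
    using sum_divisors_ramanujan_sum[of "p ^ a" x] assms by (simp add: prime_gt_0_nat)
qed

lemma sum_ramanujan_sum_prime_powers:
  assumes "prime p"
  shows "(\<Sum>k=1..a. ramanujan_sum (p ^ k) x) = (if p ^ a dvd x then int (p ^ a) else 0) - 1"
  using sum_ramanujan_sum_prime_powers_atMost[OF assms, of x a]
  by (simp add: atMost_atLeast0 sum.atLeast_Suc_atMost)

lemma ramanujan_sum_prime_power: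
  assumes "prime p"
  shows "ramanujan_sum (p ^ Suc k) x =
    (if p ^ Suc k dvd x then int (p ^ Suc k) else 0) - (if p ^ k dvd x then int (p ^ k) else 0)"
  using sum_ramanujan_sum_prime_powers_atMost[OF assms, of x k]
    sum_ramanujan_sum_prime_powers_atMost[OF assms, of x "Suc k"] by simp

lemma partial_sums_eq_imp_eq:
  fixes f g :: "nat \<Rightarrow> 'a :: ab_group_add"
  assumes "\<And>a. (\<Sum>k\<le>a. f k) = (\<Sum>k\<le>a. g k)"
  shows "f n = g n"
  using assms[of n] assms[of "n - 1"] by (cases n) auto

text \<open>The divisors of \<open>2 * p ^ a\<close> are the \<open>p ^ k\<close> and the
  \<open>2 * p ^ k\<close>. Let T be the divisor sum for \<open>p ^ a\<close>. The one for
  \<open>2 * p ^ a\<close> is 2T for even \<open>x\<close> and 0 for odd \<open>x\<close>, so the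
  doubled divisors contribute T or -T. Comparing partial sums in \<open>a\<close> gives each
  term.\<close>

lemma ramanujan_sum_double_prime_power:
  assumes p: "prime p" "p > 2"
  shows "ramanujan_sum (2 * p ^ k) x = (-1) ^ x * ramanujan_sum (p ^ k) x"
proof (rule partial_sums_eq_imp_eq[of "\<lambda>k. ramanujan_sum (2 * p ^ k) x"])
  fix a
  have odd: "odd (p ^ k)" for k using p prime_odd_nat by auto
  have cop: "coprime 2 (p ^ a)" using odd by simp
  have p0: "p > 0" using p by auto
  have inj: "inj_on (\<lambda>k. p ^ k) {..a}"
    using p by (auto simp: inj_on_def dest: prime_power_inj)
  have inj2: "inj_on (\<lambda>k. 2 * p ^ k) {..a}"
    using p by (auto simp: inj_on_def dest: prime_power_inj)
  have div: "{d. d dvd 2 * p ^ a} = (\<lambda>k. p ^ k) ` {..a} \<union> (\<lambda>k. 2 * p ^ k) ` {..a}"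
  proof (intro equalityI subsetI)
    fix d assume d: "d \<in> {d. d dvd 2 * p ^ a}"
    show "d \<in> (\<lambda>k. p ^ k) ` {..a} \<union> (\<lambda>k. 2 * p ^ k) ` {..a}"
    proof (cases "even d")
      case True
      then obtain e where "d = 2 * e" ..
      moreover with d have "e \<in> {e. e dvd p ^ a}" by simp
      ultimately show ?thesis unfolding divisors_prime_power[OF p(1)] by auto
    next
      case False
      with d have "d \<in> {e. e dvd p ^ a}" by (simp add: coprime_dvd_mult_right_iff)
      thus ?thesis unfolding divisors_prime_power[OF p(1)] by auto
    qed
  qed (use le_imp_power_dvd[of _ a p] in \<open>auto intro: dvd_mult\<close>)
  have "(\<Sum>d | d dvd 2 * p ^ a. ramanujan_sum d x) =
      (\<Sum>k\<le>a. ramanujan_sum (p ^ k) x) + (\<Sum>k\<le>a. ramanujan_sum (2 * p ^ k) x)"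
  proof -
    have "(\<lambda>k. p ^ k) ` {..a} \<inter> (\<lambda>k. 2 * p ^ k) ` {..a} = {}"
    proof -
      have "p ^ k \<noteq> 2 * p ^ l" for k l using odd[of k] by (metis dvd_triv_left)
      thus ?thesis by auto
    qed
    thus ?thesis
      unfolding div by (subst sum.union_disjoint) (auto simp: sum.reindex inj inj2)
  qed
  moreover have "(\<Sum>d | d dvd 2 * p ^ a. ramanujan_sum d x)
      = (if 2 * p ^ a dvd x then int (2 * p ^ a) else 0)"
    using sum_divisors_ramanujan_sum[of "2 * p ^ a" x] p0 by simp
  moreover have "2 * p ^ a dvd x \<longleftrightarrow> 2 dvd x \<and> p ^ a dvd x"
    using cop by (metis divides_mult dvd_mult_left dvd_mult_right)
  ultimately show "(\<Sum>k\<le>a. ramanujan_sum (2 * p ^ k) x) = (\<Sum>k\<le>a. (-1) ^ x * ramanujan_sum (p ^ k) x)"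
    unfolding sum_distrib_left[symmetric] sum_ramanujan_sum_prime_powers_atMost[OF p(1)]
    by (auto split: if_splits)
qed

text \<open>The Ramanujan sum at \<open>p ^ k\<close> is \<open>p ^ (k - 1) * (p - 1)\<close> for
  \<open>1 \<le> k \<le> v\<close>, drops to \<open>- (p ^ v)\<close> at \<open>k = v + 1\<close>
  and is 0 beyond. This is the source of the separate last term in the formulas for
  \<open>S1_hat\<close> and \<open>S2_hat\<close>.\<close>

lemma sum_ramanujan_sum_prime_powers_mult:
  fixes t :: "nat \<Rightarrow> 'a :: comm_ring_1"
  assumes p: "prime p" and x: "x > 0"
  defines "v \<equiv> multiplicity p x"
  shows "(\<Sum>k=1..x. of_int (ramanujan_sum (p ^ k) x) * t k) =
     (\<Sum>k=1..v. of_nat (p ^ (k - 1)) * (of_nat p - 1) * t k) - of_nat (p ^ v) * t (v + 1)"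
proof -
  have dvd: "p ^ k dvd x \<longleftrightarrow> k \<le> v" for k
    unfolding v_def using p x by (intro power_dvd_iff_le_multiplicity) auto
  have "p ^ v \<le> x" using dvd[of v] x by (intro dvd_imp_le) auto
  \<comment> \<open>Keeps the boundary index \<open>v + 1\<close> inside the range
    \<open>1..x\<close>.\<close>
  hence vx: "v < x"
    using power_gt_expt[of p v] prime_gt_1_nat[OF p] by simp
  have c: "ramanujan_sum (p ^ k) x = (if k \<le> v then int (p ^ (k - 1)) * (int p - 1)
      else if k = v + 1 then - int (p ^ v) else 0)" if "k \<ge> 1" for k
    using that ramanujan_sum_prime_power[OF p, of "k - 1" x] unfolding dvd
    by (cases k) (auto simp: algebra_simps)
  have "(\<Sum>k=1..x. of_int (ramanujan_sum (p ^ k) x) * t k) =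
      (\<Sum>k=1..Suc v. of_int (ramanujan_sum (p ^ k) x) * t k)"
    using vx by (intro sum.mono_neutral_right) (auto simp: c)
  also have "\<dots> = (\<Sum>k=1..v. of_int (ramanujan_sum (p ^ k) x) * t k)
      + of_int (ramanujan_sum (p ^ Suc v) x) * t (Suc v)"
    by simp
  also have "(\<Sum>k=1..v. of_int (ramanujan_sum (p ^ k) x) * t k) =
      (\<Sum>k=1..v. of_nat (p ^ (k - 1)) * (of_nat p - 1) * t k)"
    by (intro sum.cong) (auto simp: c)
  also have "of_int (ramanujan_sum (p ^ Suc v) x) * t (Suc v) = - (of_nat (p ^ v) * t (v + 1))"
    using c[of "Suc v"] by simp
  finally show ?thesis by simp
qed

section \<open>Complex powers and the interchange of summation\<close>

lemma of_nat_mult_powr: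
  "(of_nat (a * b) :: complex) powr s = of_nat a powr s * of_nat b powr s"
  using powr_times_real[of "of_nat a :: complex" "of_nat b" s] by simp

lemma of_nat_power_powr:
  assumes "p > 0"
  shows "(of_nat (p ^ k) :: complex) powr s = of_nat p powr (of_nat k * s)"
proof (induction k)
  case (Suc k)
  have "(of_nat (p ^ Suc k) :: complex) powr s = of_nat p powr s * of_nat p powr (of_nat k * s)"
    unfolding power_Suc of_nat_mult_powr Suc ..
  thus ?case by (simp add: powr_add[symmetric] algebra_simps)
qed (use assms in auto)

lemma sum_multiples_powr:
  assumes "m > 0"
  shows "(\<Sum>n | n \<in> {1..x} \<and> m dvd n. (of_nat n :: complex) powr s)
     = of_nat m powr s * gen_harm (x div m) (- s)"
proof -
  have "(\<Sum>n | n \<in> {1..x} \<and> m dvd n. (of_nat n :: complex) powr s)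
      = (\<Sum>k=1..x div m. of_nat (m * k) powr s)"
    by (rule sum.reindex_bij_witness[of _ "\<lambda>k. m * k" "\<lambda>n. n div m"])
      (use assms in \<open>auto elim!: dvdE simp: less_eq_div_iff_mult_less_eq mult.commute\<close>)
  thus ?thesis
    by (simp add: gen_harm_def of_nat_mult_powr sum_distrib_left del: of_nat_mult)
qed

text \<open>The interchange of sums behind all three formulas. The moduli form an indexed family, so
  that pairs \<open>(p, k)\<close> with modulus \<open>p ^ k\<close> or \<open>2 * p ^ k\<close> can
  serve as indices directly.\<close>

lemma sum_divisor_indexed_powr:
  assumes "finite I" "\<And>i. i \<in> I \<Longrightarrow> m i > 0"
  shows "(\<Sum>n=1..x. (\<Sum>i | i \<in> I \<and> m i dvd n. a i) * (of_nat n :: complex) powr s) =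
    (\<Sum>i\<in>I. a i * (of_nat (m i) powr s * gen_harm (x div m i) (- s)))"
proof -
  have "(\<Sum>n=1..x. (\<Sum>i | i \<in> I \<and> m i dvd n. a i) * (of_nat n :: complex) powr s) =
     (\<Sum>n\<in>{1..x}. \<Sum>i | i \<in> I \<and> m i dvd n. a i * of_nat n powr s)"
    by (simp add: sum_distrib_right)
  also have "\<dots> = (\<Sum>i\<in>I. \<Sum>n | n \<in> {1..x} \<and> m i dvd n. a i * of_nat n powr s)"
    using assms(1) by (intro sum.swap_restrict) auto
  also have "\<dots> = (\<Sum>i\<in>I. a i * (of_nat (m i) powr s * gen_harm (x div m i) (- s)))"
    using assms(2) by (intro sum.cong) (simp_all only: sum_distrib_left[symmetric] sum_multiples_powr)
  finally show ?thesis .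
qed

text \<open>Replaces ranges that depend on \<open>n\<close> by a fixed box of pairs
  \<open>(p, k)\<close>, as the interchange of sums requires. In the second part \<open>f\<close> is
  still evaluated at \<open>p ^ k\<close>, since the factor 2 has already become a sign.\<close>

lemma sum_prime_powers_dvd:
  assumes "n \<in> {1..x}"
  shows "(\<Sum>i | i \<in> {p. prime p \<and> p \<le> x} \<times> {1..x} \<and> fst i ^ snd i dvd n. f (fst i ^ snd i)) =
    (\<Sum>p | prime p \<and> p dvd n. \<Sum>k=1..multiplicity p n. f (p ^ k))" (is ?A)
    and "(\<Sum>i | i \<in> {p. prime p \<and> p > 2 \<and> p \<le> x} \<times> {1..x} \<and> 2 * fst i ^ snd i dvd n. f (fst i ^ snd i)) =
    (\<Sum>p | prime p \<and> p > 2 \<and> 2 * p dvd n. \<Sum>k=1..multiplicity p n. f (p ^ k))" (is ?B)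
proof -
  have n: "n > 0" "n \<le> x" using assms by auto
  have dvd: "p ^ k dvd n \<longleftrightarrow> k \<le> multiplicity p n" if "prime p" for p k
    using that n by (intro power_dvd_iff_le_multiplicity) auto
  \<comment> \<open>Since \<open>k < p ^ k \<le> n \<le> x\<close>, exponents up to \<open>x\<close>
    suffice.\<close>
  have le: "k \<le> x" if "prime p" "p ^ k dvd n" for p k
    using power_gt_expt[of p k] prime_gt_1_nat[OF that(1)] dvd_imp_le[OF that(2) n(1)] n(2) by simp
  have dvd2: "2 * p ^ k dvd n \<longleftrightarrow> even n \<and> p ^ k dvd n" if "prime p" "p > 2" for p k
  proof -
    have "coprime 2 (p ^ k)" using that prime_odd_nat by auto
    thus ?thesis by (metis divides_mult dvd_mult_left dvd_mult_right)
  qed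
  have 1: "{i. i \<in> {p. prime p \<and> p \<le> x} \<times> {1..x} \<and> fst i ^ snd i dvd n} =
      (SIGMA p:{p. prime p \<and> p dvd n}. {1..multiplicity p n})"
  proof (intro equalityI subsetI)
    fix i assume "i \<in> {i. i \<in> {p. prime p \<and> p \<le> x} \<times> {1..x} \<and> fst i ^ snd i dvd n}"
    thus "i \<in> (SIGMA p:{p. prime p \<and> p dvd n}. {1..multiplicity p n})"
      by (cases i) (auto simp: dvd[symmetric] intro: dvd_power dvd_trans)
  next
    fix i assume "i \<in> (SIGMA p:{p. prime p \<and> p dvd n}. {1..multiplicity p n})"
    thus "i \<in> {i. i \<in> {p. prime p \<and> p \<le> x} \<times> {1..x} \<and> fst i ^ snd i dvd n}"
      using n by (cases i) (auto simp: dvd[symmetric] le dest: dvd_imp_le)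
  qed
  have 2: "{i. i \<in> {p. prime p \<and> p > 2 \<and> p \<le> x} \<times> {1..x} \<and> 2 * fst i ^ snd i dvd n} =
      (SIGMA p:{p. prime p \<and> p > 2 \<and> 2 * p dvd n}. {1..multiplicity p n})"
  proof (intro equalityI subsetI)
    fix i assume "i \<in> {i. i \<in> {p. prime p \<and> p > 2 \<and> p \<le> x} \<times> {1..x} \<and> 2 * fst i ^ snd i dvd n}"
    thus "i \<in> (SIGMA p:{p. prime p \<and> p > 2 \<and> 2 * p dvd n}. {1..multiplicity p n})"
      using dvd2[of _ 1] by (cases i) (auto simp: dvd2 dvd[symmetric] intro: dvd_power dvd_trans)
  next
    fix i assume "i \<in> (SIGMA p:{p. prime p \<and> p > 2 \<and> 2 * p dvd n}. {1..multiplicity p n})"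
    thus "i \<in> {i. i \<in> {p. prime p \<and> p > 2 \<and> p \<le> x} \<times> {1..x} \<and> 2 * fst i ^ snd i dvd n}"
      using n dvd2[of _ 1] by (cases i) (auto simp: dvd2 dvd[symmetric] le dest: dvd_imp_le)
  qed
  have fin: "finite {p. P p \<and> p dvd n}" "finite {p. P p \<and> p > 2 \<and> 2 * p dvd n}" for P
    using n by (auto intro!: finite_subset[OF _ finite_divisors_nat[OF n(1)]] dest: dvd_mult_right)
  show ?A
    unfolding 1 using fin by (subst sum.Sigma) (auto intro!: sum.cong)
  show ?B
    unfolding 2 using fin by (subst sum.Sigma) (auto intro!: sum.cong)
qed

section \<open>The three coefficients in terms of Ramanujan sums\<close>

lemma S0_hat_eq:
  "S0_hat \<beta> x = (\<Sum>n=1..x. (\<Sum>d | d dvd n \<and> d > 1 \<and> \<not> prime_power_or_double d.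
      of_int (ramanujan_sum d x)) * of_nat n powr (\<beta> - 1))"
proof -
  have "S0_tilde n has_laurent_expansion fps_to_fls (Abs_fps (\<lambda>x.
      \<Sum>d | d dvd n \<and> d > 1 \<and> \<not> prime_power_or_double d. primitive_root_sum d x))" for n
    unfolding S0_tilde_def by (intro has_laurent_expansion_fps_sum Phi_tilde_expansion)
  hence "S0_hat \<beta> x = (\<Sum>n=1..x. (\<Sum>d | d dvd n \<and> d > 1 \<and> \<not> prime_power_or_double d.
      primitive_root_sum d x) * of_nat n powr (\<beta> - 1))"
    by (intro S_hat_eq)
  thus ?thesis
    by (simp add: primitive_root_sum_eq_ramanujan_sum)
qed

text \<open>The \<open>- 1\<close> in each coefficient of \<open>Pi_fun\<close> removes the term
  \<open>k = 0\<close>, the Ramanujan sum at 1, from the divisor sum of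
  \<open>p ^ multiplicity p n\<close>.\<close>

lemma S1_hat_eq:
  "S1_hat \<beta> x = (\<Sum>n=1..x. (\<Sum>p | prime p \<and> p dvd n. \<Sum>k=1..multiplicity p n.
      of_int (ramanujan_sum (p ^ k) x)) * of_nat n powr (\<beta> - 1))"
proof -
  have "S1_tilde n has_laurent_expansion fps_to_fls (Abs_fps (\<lambda>x.
      \<Sum>p | prime p \<and> p dvd n. \<Sum>k=1..multiplicity p n. of_int (ramanujan_sum (p ^ k) x)))" for n
    unfolding S1_tilde_def
  proof (intro has_laurent_expansion_fps_sum has_laurent_expansion_fps)
    fix p assume "p \<in> {p. prime p \<and> p dvd n}"
    hence p: "prime p" by simp
    hence "p ^ multiplicity p n > 0" by (simp add: prime_gt_0_nat)
    from Pi_fun_expansion[OF this]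
    show "Pi_fun (p ^ multiplicity p n) has_fps_expansion
        Abs_fps (\<lambda>x. \<Sum>k=1..multiplicity p n. of_int (ramanujan_sum (p ^ k) x))"
      unfolding of_int_sum[symmetric] sum_ramanujan_sum_prime_powers[OF p]
      by (rule has_fps_expansion_schematicI) (auto intro!: fps_ext)
  qed
  thus ?thesis
    by (intro S_hat_eq)
qed

text \<open>The sign stays explicit because the closed formula needs it; only the identity for
  \<open>divisor_sigma\<close> trades it for the Ramanujan sums at \<open>2 * p ^ k\<close>.\<close>

lemma S2_hat_eq:
  "S2_hat \<beta> x = (\<Sum>n=1..x. (\<Sum>p | prime p \<and> p > 2 \<and> 2 * p dvd n. \<Sum>k=1..multiplicity p n.
      (-1) ^ x * of_int (ramanujan_sum (p ^ k) x)) * of_nat n powr (\<beta> - 1))"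
proof -
  have "S2_tilde n has_laurent_expansion fps_to_fls (Abs_fps (\<lambda>x.
      \<Sum>p | prime p \<and> p > 2 \<and> 2 * p dvd n. \<Sum>k=1..multiplicity p n.
        (-1) ^ x * of_int (ramanujan_sum (p ^ k) x)))" for n
    unfolding S2_tilde_def
  proof (intro has_laurent_expansion_fps_sum has_laurent_expansion_fps)
    fix p assume "p \<in> {p. prime p \<and> p > 2 \<and> 2 * p dvd n}"
    hence p: "prime p" by simp
    hence "p ^ multiplicity p n > 0" by (simp add: prime_gt_0_nat)
    from has_fps_expansion_uminus_arg[OF Pi_fun_expansion[OF this]]
    show "(\<lambda>q. Pi_fun (p ^ multiplicity p n) (- q)) has_fps_expansion
        Abs_fps (\<lambda>x. \<Sum>k=1..multiplicity p n. (-1) ^ x * of_int (ramanujan_sum (p ^ k) x))"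
      unfolding sum_distrib_left[symmetric] of_int_sum[symmetric] sum_ramanujan_sum_prime_powers[OF p]
      by (rule has_fps_expansion_schematicI) (auto intro!: fps_ext)
  qed
  thus ?thesis
    by (intro S_hat_eq)
qed

section \<open>Closed formulas with generalized harmonic numbers\<close>

lemma S0_hat_formula:
  "S0_hat (- \<alpha>) x = (\<Sum>d=2..x. gen_harm (x div d) (\<alpha> + 1)
      * (of_int (ramanujan_sum d x) / of_nat d powr (\<alpha> + 1)) * chi_P d)"
proof -
  \<comment> \<open>Divisors of any \<open>n \<le> x\<close> are at most \<open>x\<close>, so one
    index set serves all \<open>n\<close>; on \<open>2..x\<close> its indicator is
    \<open>chi_P\<close>.\<close>
  let ?I = "{d \<in> {2..x}. \<not> prime_power_or_double d}"
  have "S0_hat (- \<alpha>) x = (\<Sum>n=1..x. (\<Sum>d | d \<in> ?I \<and> d dvd n. of_int (ramanujan_sum d x))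
      * of_nat n powr (- (\<alpha> + 1)))"
    unfolding S0_hat_eq
  proof (intro sum.cong arg_cong2[of _ _ _ _ "(*)"] refl)
    fix n assume "n \<in> {1..x}"
    thus "{d. d dvd n \<and> d > 1 \<and> \<not> prime_power_or_double d} = {d. d \<in> ?I \<and> d dvd n}"
      by (auto dest: dvd_imp_le)
  qed simp
  also have "\<dots> = (\<Sum>d\<in>?I. of_int (ramanujan_sum d x) *
      (of_nat d powr (- (\<alpha> + 1)) * gen_harm (x div d) (\<alpha> + 1)))"
    by (subst sum_divisor_indexed_powr) (auto simp: add.commute)
  also have "\<dots> = (\<Sum>d\<in>?I. gen_harm (x div d) (\<alpha> + 1)
      * (of_int (ramanujan_sum d x) / of_nat d powr (\<alpha> + 1)) * chi_P d)"
    by (intro sum.cong refl) (auto simp: chi_P_def powr_minus divide_inverse simp del: minus_add_distrib)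
  also have "\<dots> = (\<Sum>d=2..x. gen_harm (x div d) (\<alpha> + 1)
      * (of_int (ramanujan_sum d x) / of_nat d powr (\<alpha> + 1)) * chi_P d)"
    by (rule sum.mono_neutral_left) (auto simp: chi_P_def)
  finally show ?thesis .
qed

text \<open>Exponent arithmetic: \<open>(k - 1) - k * (\<alpha> + 1)\<close> is
  \<open>- (\<alpha> * k + 1)\<close>, and \<open>k - (k + 1) * (\<alpha> + 1)\<close> is
  \<open>- (\<alpha> * k + \<alpha> + 1)\<close>.\<close>

lemma prime_power_weights:
  assumes "p > 0"
  shows "k \<ge> 1 \<Longrightarrow> of_nat (p ^ (k - 1)) * (of_nat (p ^ k) :: complex) powr (- (\<alpha> + 1))
      = 1 / of_nat p powr (\<alpha> * of_nat k + 1)"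
    and "of_nat (p ^ k) * (of_nat (p ^ (k + 1)) :: complex) powr (- (\<alpha> + 1))
      = 1 / of_nat p powr (\<alpha> * of_nat k + \<alpha> + 1)"
proof -
  have pw: "(of_nat (p ^ j) :: complex) = of_nat p powr of_nat j" for j
    using assms by (simp add: powr_nat')
  show "of_nat (p ^ (k - 1)) * (of_nat (p ^ k) :: complex) powr (- (\<alpha> + 1))
      = 1 / of_nat p powr (\<alpha> * of_nat k + 1)" if "k \<ge> 1"
    unfolding of_nat_power_powr[OF assms] pw[of "k - 1"] powr_add[symmetric] powr_minus_divide[symmetric]
    using that by (simp add: of_nat_diff algebra_simps)
  show "of_nat (p ^ k) * (of_nat (p ^ (k + 1)) :: complex) powr (- (\<alpha> + 1))
      = 1 / of_nat p powr (\<alpha> * of_nat k + \<alpha> + 1)"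
    unfolding of_nat_power_powr[OF assms] pw[of k] powr_add[symmetric] powr_minus_divide[symmetric]
    by (simp add: algebra_simps)
qed

text \<open>The factor \<open>h\<close> is arbitrary, so that it can be \<open>gen_harm\<close> at
  \<open>x div p ^ k\<close> as well as at \<open>x div (2 * p ^ k)\<close>.\<close>

lemma sum_ramanujan_sum_prime_powers_powr:
  fixes \<alpha> :: complex
  assumes p: "prime p" and x: "x > 0"
  shows "(\<Sum>k=1..x. of_int (ramanujan_sum (p ^ k) x) * (of_nat (p ^ k) powr (- (\<alpha> + 1)) * h k)) =
     (\<Sum>k=1..multiplicity p x. (of_nat p - 1) / of_nat p powr (\<alpha> * of_nat k + 1) * h k)
      - 1 / of_nat p powr (\<alpha> * of_nat (multiplicity p x) + \<alpha> + 1) * h (multiplicity p x + 1)"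
proof -
  have p0: "p > 0" using p by (simp add: prime_gt_0_nat)
  have w: "of_nat (p ^ (k - 1)) * (of_nat p - 1) * (of_nat (p ^ k) powr (- (\<alpha> + 1)) * h k) =
      (of_nat p - 1) / of_nat p powr (\<alpha> * of_nat k + 1) * h k" if "k \<ge> 1" for k
  proof -
    have "of_nat (p ^ (k - 1)) * (of_nat p - 1) * (of_nat (p ^ k) powr (- (\<alpha> + 1)) * h k) =
      (of_nat p - 1) * (of_nat (p ^ (k - 1)) * of_nat (p ^ k) powr (- (\<alpha> + 1))) * h k"
      by (simp only: mult_ac)
    thus ?thesis unfolding prime_power_weights(1)[OF p0 that] by simp
  qed
  have "(\<Sum>k=1..multiplicity p x. of_nat (p ^ (k - 1)) * (of_nat p - 1) * (of_nat (p ^ k) powr (- (\<alpha> + 1)) * h k)) =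
      (\<Sum>k=1..multiplicity p x. (of_nat p - 1) / of_nat p powr (\<alpha> * of_nat k + 1) * h k)"
    by (intro sum.cong refl w) auto
  moreover have "of_nat (p ^ multiplicity p x) * (of_nat (p ^ (multiplicity p x + 1)) powr (- (\<alpha> + 1)) * h (multiplicity p x + 1)) =
      1 / of_nat p powr (\<alpha> * of_nat (multiplicity p x) + \<alpha> + 1) * h (multiplicity p x + 1)"
    unfolding prime_power_weights(2)[OF p0, symmetric] by (simp only: mult.assoc)
  ultimately show ?thesis
    unfolding sum_ramanujan_sum_prime_powers_mult[OF assms] by (simp only:)
qed

text \<open>The sum runs over all primes up to \<open>x\<close>: those not dividing \<open>x\<close>
  have an empty inner sum but still contribute the boundary term.\<close>

lemma S1_hat_formula:
  assumes x: "x > 0"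
  shows "S1_hat (- \<alpha>) x =
    (\<Sum>p | prime p \<and> p \<le> x.
      (\<Sum>k=1..multiplicity p x.
         (of_nat p - 1) / of_nat p powr (\<alpha> * of_nat k + 1) * gen_harm (x div p ^ k) (\<alpha> + 1))
      - 1 / of_nat p powr (\<alpha> * of_nat (multiplicity p x) + \<alpha> + 1)
          * gen_harm (x div p ^ (multiplicity p x + 1)) (\<alpha> + 1))"
proof -
  let ?P = "{p. prime p \<and> p \<le> x}"
  let ?I = "?P \<times> {1..x}"
  let ?c = "\<lambda>d. of_int (ramanujan_sum d x) :: complex"
  have "S1_hat (- \<alpha>) x = (\<Sum>n=1..x. (\<Sum>i | i \<in> ?I \<and> fst i ^ snd i dvd n. ?c (fst i ^ snd i))
      * of_nat n powr (- (\<alpha> + 1)))"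
    unfolding S1_hat_eq
  proof (rule sum.cong[OF refl])
    fix n assume "n \<in> {1..x}"
    from sum_prime_powers_dvd(1)[OF this, of ?c] show
      "(\<Sum>p | prime p \<and> p dvd n. \<Sum>k=1..multiplicity p n. ?c (p ^ k)) * of_nat n powr (- \<alpha> - 1) =
       (\<Sum>i | i \<in> ?I \<and> fst i ^ snd i dvd n. ?c (fst i ^ snd i)) * of_nat n powr (- (\<alpha> + 1))"
      by (simp only:) simp
  qed
  also have "\<dots> = (\<Sum>i\<in>?I. ?c (fst i ^ snd i) *
      (of_nat (fst i ^ snd i) powr (- (\<alpha> + 1)) * gen_harm (x div fst i ^ snd i) (- (- (\<alpha> + 1)))))"
    by (rule sum_divisor_indexed_powr) (auto simp: prime_gt_0_nat)
  also have "\<dots> = (\<Sum>p\<in>?P. \<Sum>k=1..x. ?c (p ^ k) *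
      (of_nat (p ^ k) powr (- (\<alpha> + 1)) * gen_harm (x div p ^ k) (\<alpha> + 1)))"
    by (simp add: sum.cartesian_product case_prod_unfold add.commute)
  also have "\<dots> = (\<Sum>p\<in>?P.
      (\<Sum>k=1..multiplicity p x.
         (of_nat p - 1) / of_nat p powr (\<alpha> * of_nat k + 1) * gen_harm (x div p ^ k) (\<alpha> + 1))
      - 1 / of_nat p powr (\<alpha> * of_nat (multiplicity p x) + \<alpha> + 1)
          * gen_harm (x div p ^ (multiplicity p x + 1)) (\<alpha> + 1))"
    by (rule sum.cong[OF refl], rule sum_ramanujan_sum_prime_powers_powr) (use x in auto)
  finally show ?thesis .
qed

lemma S2_hat_formula:
  assumes x: "x > 0"
  shows "S2_hat (- \<alpha>) x =
    (-1) ^ x / 2 powr (\<alpha> + 1) *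
    (\<Sum>p | prime p \<and> p > 2 \<and> p \<le> x.
      (\<Sum>k=1..multiplicity p x.
         (of_nat p - 1) / of_nat p powr (\<alpha> * of_nat k + 1) * gen_harm (x div (2 * p ^ k)) (\<alpha> + 1))
      - 1 / of_nat p powr (\<alpha> * of_nat (multiplicity p x) + \<alpha> + 1)
          * gen_harm (x div (2 * p ^ (multiplicity p x + 1))) (\<alpha> + 1))"
proof -
  let ?P = "{p. prime p \<and> p > 2 \<and> p \<le> x}"
  let ?I = "?P \<times> {1..x}"
  let ?c = "\<lambda>d. of_int (ramanujan_sum d x) :: complex"
  have "S2_hat (- \<alpha>) x = (\<Sum>n=1..x. (\<Sum>i | i \<in> ?I \<and> 2 * fst i ^ snd i dvd n. (-1) ^ x * ?c (fst i ^ snd i))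
      * of_nat n powr (- (\<alpha> + 1)))"
    unfolding S2_hat_eq
  proof (rule sum.cong[OF refl])
    fix n assume "n \<in> {1..x}"
    from sum_prime_powers_dvd(2)[OF this, of "\<lambda>d. (-1) ^ x * ?c d"] show
      "(\<Sum>p | prime p \<and> p > 2 \<and> 2 * p dvd n. \<Sum>k=1..multiplicity p n. (-1) ^ x * ?c (p ^ k))
         * of_nat n powr (- \<alpha> - 1) =
       (\<Sum>i | i \<in> ?I \<and> 2 * fst i ^ snd i dvd n. (-1) ^ x * ?c (fst i ^ snd i)) * of_nat n powr (- (\<alpha> + 1))"
      by (simp only:) simp
  qed
  also have "\<dots> = (\<Sum>i\<in>?I. (-1) ^ x * ?c (fst i ^ snd i) *
      (of_nat (2 * fst i ^ snd i) powr (- (\<alpha> + 1)) * gen_harm (x div (2 * fst i ^ snd i)) (- (- (\<alpha> + 1)))))"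
    by (rule sum_divisor_indexed_powr) (auto simp: prime_gt_0_nat)
  also have "\<dots> = (\<Sum>p\<in>?P. \<Sum>k=1..x. (-1) ^ x * ?c (p ^ k) *
      (of_nat (2 * p ^ k) powr (- (\<alpha> + 1)) * gen_harm (x div (2 * p ^ k)) (\<alpha> + 1)))"
    by (simp add: sum.cartesian_product case_prod_unfold add.commute)
  \<comment> \<open>The factor 2 of every modulus splits off as a common power.\<close>
  also have "\<dots> = (-1) ^ x / 2 powr (\<alpha> + 1) * (\<Sum>p\<in>?P. \<Sum>k=1..x. ?c (p ^ k) *
      (of_nat (p ^ k) powr (- (\<alpha> + 1)) * gen_harm (x div (2 * p ^ k)) (\<alpha> + 1)))"
    unfolding sum_distrib_left of_nat_mult_powr powr_minus_divide[of "of_nat 2"]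
    by (intro sum.cong refl) simp
  also have "(\<Sum>p\<in>?P. \<Sum>k=1..x. ?c (p ^ k) *
      (of_nat (p ^ k) powr (- (\<alpha> + 1)) * gen_harm (x div (2 * p ^ k)) (\<alpha> + 1))) = (\<Sum>p\<in>?P.
      (\<Sum>k=1..multiplicity p x.
         (of_nat p - 1) / of_nat p powr (\<alpha> * of_nat k + 1) * gen_harm (x div (2 * p ^ k)) (\<alpha> + 1))
      - 1 / of_nat p powr (\<alpha> * of_nat (multiplicity p x) + \<alpha> + 1)
          * gen_harm (x div (2 * p ^ (multiplicity p x + 1))) (\<alpha> + 1))"
    by (rule sum.cong[OF refl], rule sum_ramanujan_sum_prime_powers_powr) (use x in auto)
  finally show ?thesis .
qed

section \<open>Assembly of the divisor function\<close>

text \<open>Each divisor is exactly one of: 1, a prime power, twice a power of an odd prime, or none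
  of these. Restricting the third class to odd primes avoids counting powers of 2 twice.\<close>

lemma sum_divisors_split:
  fixes f :: "nat \<Rightarrow> 'a :: comm_monoid_add"
  assumes n: "n > 0"
  shows "(\<Sum>d | d dvd n. f d) = f 1 + (\<Sum>d | d dvd n \<and> d > 1 \<and> \<not> prime_power_or_double d. f d)
     + (\<Sum>p | prime p \<and> p dvd n. \<Sum>k=1..multiplicity p n. f (p ^ k))
     + (\<Sum>p | prime p \<and> p > 2 \<and> 2 * p dvd n. \<Sum>k=1..multiplicity p n. f (2 * p ^ k))"
proof -
  have dvd: "p ^ k dvd n \<longleftrightarrow> k \<le> multiplicity p n" if "prime p" for p k
    using that n by (intro power_dvd_iff_le_multiplicity) auto
  have odd: "odd (p ^ k)" if "prime p" "p > 2" for p k :: nat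
    using that prime_odd_nat by auto
  have dvd2: "2 * p ^ k dvd n \<longleftrightarrow> even n \<and> p ^ k dvd n" if "prime p" "p > 2" for p k
  proof -
    have "coprime 2 (p ^ k)" using odd[OF that] by simp
    thus ?thesis by (metis divides_mult dvd_mult_left dvd_mult_right)
  qed
  define R where "R = {d. d dvd n \<and> d > 1 \<and> \<not> prime_power_or_double d}"
  define I where "I = (SIGMA p:{p. prime p \<and> p dvd n}. {1..multiplicity p n})"
  define J where "J = (SIGMA p:{p. prime p \<and> p > 2 \<and> 2 * p dvd n}. {1..multiplicity p n})"
  define A where "A = (\<lambda>(p, k). p ^ k) ` I"
  define B where "B = (\<lambda>(p, k). 2 * p ^ k) ` J"
  have fin: "finite {p. prime p \<and> p dvd n}" "finite {p. prime p \<and> p > 2 \<and> 2 * p dvd n}" "finite {d. d dvd n}"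
    using n by (auto intro!: finite_subset[OF _ finite_divisors_nat[OF n]] dest: dvd_mult_right)
  have A: "A = {d. d dvd n \<and> (\<exists>p k. prime p \<and> k \<ge> 1 \<and> d = p ^ k)}"
  proof (intro equalityI subsetI)
    fix d assume "d \<in> {d. d dvd n \<and> (\<exists>p k. prime p \<and> k \<ge> 1 \<and> d = p ^ k)}"
    then obtain p k where d: "d dvd n" "prime p" "k \<ge> 1" "d = p ^ k" by blast
    hence "p dvd n" by (auto intro: dvd_trans[OF dvd_power])
    with d dvd have "(p, k) \<in> I" by (simp add: I_def)
    thus "d \<in> A" unfolding A_def by (rule rev_image_eqI) (simp add: d)
  next
    fix d assume "d \<in> A"
    then obtain p k where "(p, k) \<in> I" "d = p ^ k" by (auto simp: A_def)
    thus "d \<in> {d. d dvd n \<and> (\<exists>p k. prime p \<and> k \<ge> 1 \<and> d = p ^ k)}"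
      using dvd by (auto simp: I_def)
  qed
  have B: "B = {d. d dvd n \<and> (\<exists>p k. prime p \<and> p > 2 \<and> k \<ge> 1 \<and> d = 2 * p ^ k)}"
  proof (intro equalityI subsetI)
    fix d assume "d \<in> {d. d dvd n \<and> (\<exists>p k. prime p \<and> p > 2 \<and> k \<ge> 1 \<and> d = 2 * p ^ k)}"
    then obtain p k where d: "d dvd n" "prime p" "p > 2" "k \<ge> 1" "d = 2 * p ^ k" by blast
    hence "p dvd n" "even n" "p ^ k dvd n" using dvd2 by (auto intro: dvd_trans[OF dvd_power])
    with d dvd dvd2[of p 1] have "(p, k) \<in> J" by (simp add: J_def)
    thus "d \<in> B" unfolding B_def by (rule rev_image_eqI) (simp add: d)
  next
    fix d assume "d \<in> B"
    then obtain p k where d: "(p, k) \<in> J" "d = 2 * p ^ k" by (auto simp: B_def)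
    with dvd2[of p 1] dvd2[of p k] dvd[of p k]
    show "d \<in> {d. d dvd n \<and> (\<exists>p k. prime p \<and> p > 2 \<and> k \<ge> 1 \<and> d = 2 * p ^ k)}"
      by (auto simp: J_def)
  qed
  have AB: "A \<union> B = {d. d dvd n \<and> prime_power_or_double d}"
  proof (intro equalityI subsetI)
    fix d assume "d \<in> {d. d dvd n \<and> prime_power_or_double d}"
    then obtain p k where d: "d dvd n" "prime p" "k \<ge> 1" "d = p ^ k \<or> d = 2 * p ^ k"
      unfolding prime_power_or_double_def by blast
    show "d \<in> A \<union> B"
    proof (cases "d = p ^ k")
      case True
      with d show ?thesis unfolding A by blast
    next
      case False
      show ?thesis
      \<comment> \<open>Twice a power of 2 is again a prime power and belongs to
        \<open>A\<close>.\<close>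
      proof (cases "p = 2")
        case True
        with d False have "d = 2 ^ Suc k" by simp
        with d show ?thesis unfolding A by (intro UnI1 CollectI conjI exI[of _ 2] exI[of _ "Suc k"]) auto
      next
        case neq: False
        with d prime_ge_2_nat[of p] have "p > 2" by simp
        with d False show ?thesis unfolding B by blast
      qed
    qed
  qed (auto simp: A B prime_power_or_double_def)
  have disj: "A \<inter> B = {}"
  proof (rule ccontr)
    assume "A \<inter> B \<noteq> {}"
    then obtain p k q l :: nat where *: "prime p" "prime q" "q > 2" "l \<ge> 1" "p ^ k = 2 * q ^ l"
      unfolding A B by auto
    hence "q dvd p ^ k" by (simp add: dvd_power dvd_mult)
    hence "q dvd p" using *(2) by (rule prime_dvd_power[rotated])
    hence "q = p" using * by (simp add: primes_dvd_imp_eq)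
    have "2 dvd p ^ k" unfolding *(5) by simp
    hence "2 dvd p" by (rule prime_dvd_power[OF two_is_prime_nat])
    with \<open>q = p\<close> * show False using prime_odd_nat[of p] by simp
  qed
  have 1: "(\<Sum>p | prime p \<and> p dvd n. \<Sum>k=1..multiplicity p n. f (p ^ k)) = sum f A"
  proof -
    \<comment> \<open>Unique factorization; exponents start at 1, without which
      \<open>p ^ 0 = q ^ 0\<close> would break injectivity.\<close>
    have "inj_on (\<lambda>(p, k). p ^ k) I"
    proof (rule inj_onI, clarify)
      fix p k q l assume "(p, k) \<in> I" "(q, l) \<in> I" "p ^ k = q ^ l"
      thus "p = q \<and> k = l"
        using prime_power_inj'[of p q k l] by (simp add: I_def)
    qed
    thus ?thesis
      using fin by (simp add: A_def sum.reindex I_def sum.Sigma case_prod_unfold)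
  qed
  have 2: "(\<Sum>p | prime p \<and> p > 2 \<and> 2 * p dvd n. \<Sum>k=1..multiplicity p n. f (2 * p ^ k)) = sum f B"
  proof -
    have "inj_on (\<lambda>(p, k). 2 * p ^ k) J"
    proof (rule inj_onI, clarify)
      fix p k q l assume "(p, k) \<in> J" "(q, l) \<in> J" "2 * p ^ k = 2 * q ^ l"
      thus "p = q \<and> k = l"
        using prime_power_inj'[of p q k l] by (simp add: J_def)
    qed
    thus ?thesis
      using fin by (simp add: B_def sum.reindex J_def sum.Sigma case_prod_unfold)
  qed
  have fAB: "finite A" "finite B" "finite R"
    using fin(3) by (auto intro: finite_subset[of _ "{d. d dvd n}"] simp: A B R_def)
  have "\<not> prime_power_or_double 1"
    by (auto simp: prime_power_or_double_def simp del: One_nat_def)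
  hence "{d. d dvd n} = insert 1 (R \<union> (A \<union> B))" "1 \<notin> R \<union> (A \<union> B)"
    unfolding AB R_def using n by (auto intro: Nat.gr0I simp: not_less le_Suc_eq)
  hence "(\<Sum>d | d dvd n. f d) = f 1 + sum f (R \<union> (A \<union> B))"
    using fAB by simp
  also have "sum f (R \<union> (A \<union> B)) = sum f R + (sum f A + sum f B)"
  proof -
    have "R \<inter> (A \<union> B) = {}" unfolding AB R_def by auto
    thus ?thesis using fAB disj by (simp add: sum.union_disjoint)
  qed
  finally show ?thesis
    unfolding 1 2 R_def[symmetric] by (simp add: add.assoc)
qed

lemma divisor_sigma_eq_S_hats:
  assumes x: "x > 0"
  shows "divisor_sigma \<alpha> x = of_nat x powr \<alpha> *
    (gen_harm x (\<alpha> + 1) + S0_hat (- \<alpha>) x + S1_hat (- \<alpha>) x + S2_hat (- \<alpha>) x)"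
proof -
  let ?s = "- \<alpha> - 1"
  let ?c = "\<lambda>d. of_int (ramanujan_sum d x) :: complex"
  have S2: "S2_hat (- \<alpha>) x = (\<Sum>n=1..x. (\<Sum>p | prime p \<and> p > 2 \<and> 2 * p dvd n.
      \<Sum>k=1..multiplicity p n. ?c (2 * p ^ k)) * of_nat n powr ?s)"
    unfolding S2_hat_eq by (intro sum.cong arg_cong2[of _ _ _ _ "(*)"] refl)
      (simp add: ramanujan_sum_double_prime_power)
  have "gen_harm x (\<alpha> + 1) + S0_hat (- \<alpha>) x + S1_hat (- \<alpha>) x + S2_hat (- \<alpha>) x =
     (\<Sum>n=1..x. (\<Sum>d | d dvd n. ?c d) * of_nat n powr ?s)"
    \<comment> \<open>The harmonic number supplies the divisor \<open>d = 1\<close>, whose Ramanujan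
      sum is 1.\<close>
    unfolding S0_hat_eq S1_hat_eq S2 gen_harm_def sum.distrib[symmetric]
    by (intro sum.cong refl) (auto simp: sum_divisors_split[where f = ?c] distrib_right)
  also have "\<dots> = (\<Sum>n=1..x. if n dvd x then of_nat n powr (- \<alpha>) else 0)"
  proof (intro sum.cong refl)
    fix n assume "n \<in> {1..x}"
    hence n: "n > 0" by simp
    have "(of_nat n :: complex) * of_nat n powr ?s = of_nat n powr 1 * of_nat n powr ?s"
      by simp
    also have "\<dots> = of_nat n powr (- \<alpha>)"
      unfolding powr_add[symmetric] by simp
    finally show "(\<Sum>d | d dvd n. ?c d) * of_nat n powr ?s = (if n dvd x then of_nat n powr (- \<alpha>) else 0)"
      unfolding of_int_sum[symmetric] sum_divisors_ramanujan_sum[OF n] by simp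
  qed
  also have "\<dots> = (\<Sum>n | n dvd x. of_nat n powr (- \<alpha>))"
    using x by (intro sum.mono_neutral_cong_right) (auto dest: dvd_imp_le intro: Nat.gr0I)
  \<comment> \<open>Passing to the complementary divisor \<open>x div n\<close> turns the exponent
    \<open>- \<alpha>\<close> into \<open>\<alpha>\<close>.\<close>
  also have "of_nat x powr \<alpha> * \<dots> = (\<Sum>n | n dvd x. of_nat (x div n) powr \<alpha>)"
    unfolding sum_distrib_left
  proof (intro sum.cong refl)
    fix n assume "n \<in> {n. n dvd x}"
    then obtain m where m: "x = n * m" by auto
    hence "(of_nat x :: complex) powr \<alpha> = of_nat n powr \<alpha> * of_nat m powr \<alpha>"
      by (simp only: of_nat_mult_powr)
    with m x show "of_nat x powr \<alpha> * of_nat n powr (- \<alpha>) = of_nat (x div n) powr \<alpha>"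
      by (simp add: powr_minus)
  qed
  also have "\<dots> = divisor_sigma \<alpha> x"
    unfolding divisor_sigma_def using x
    by (intro sum.reindex_bij_witness[of _ "(div) x" "(div) x"]) (auto elim: dvdE)
  finally show ?thesis ..
qed

theorem mainTheorem3:
  fixes \<alpha> :: complex and x :: nat
  assumes "x \<ge> 1"
  shows "(S0_hat (- \<alpha>) x =
           (\<Sum>d=2..x. gen_harm (x div d) (\<alpha> + 1)
              * (of_int (ramanujan_sum d x) / of_nat d powr (\<alpha> + 1)) * chi_P d)) \<and>
         (S1_hat (- \<alpha>) x =
           (\<Sum>p | prime p \<and> p \<le> x.
              (\<Sum>k=1..multiplicity p x.
                 (of_nat p - 1) / of_nat p powr (\<alpha> * of_nat k + 1)
                   * gen_harm (x div p ^ k) (\<alpha> + 1))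
              - 1 / of_nat p powr (\<alpha> * of_nat (multiplicity p x) + \<alpha> + 1)
                  * gen_harm (x div p ^ (multiplicity p x + 1)) (\<alpha> + 1))) \<and>
         (S2_hat (- \<alpha>) x =
           (-1) ^ x / 2 powr (\<alpha> + 1) *
           (\<Sum>p | prime p \<and> p > 2 \<and> p \<le> x.
              (\<Sum>k=1..multiplicity p x.
                 (of_nat p - 1) / of_nat p powr (\<alpha> * of_nat k + 1)
                   * gen_harm (x div (2 * p ^ k)) (\<alpha> + 1))
              - 1 / of_nat p powr (\<alpha> * of_nat (multiplicity p x) + \<alpha> + 1)
                  * gen_harm (x div (2 * p ^ (multiplicity p x + 1))) (\<alpha> + 1))) \<and>
         (divisor_sigma \<alpha> x =
           of_nat x powr \<alpha> *
           (gen_harm x (\<alpha> + 1) + S0_hat (- \<alpha>) x + S1_hat (- \<alpha>) x + S2_hat (- \<alpha>) x))"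
proof -
  have x: "x > 0" using assms by simp
  show ?thesis
    by (intro conjI S0_hat_formula S1_hat_formula[OF x] S2_hat_formula[OF x] divisor_sigma_eq_S_hats[OF x])
qed

end
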